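(* For any $n\in\mathbf N$, $a\in\mathbf N\cap[0,F_{n-1}]$ and $b\in\mathbf N\cap[0,F_n]$, except the case in which all tiles are taken ($a=F_{n-1}$ and $b=F_n$), an $(n,a,b)$-Ammann Chair Fractal has similarity dimension $$d(n,a,b)=2\log_\phi x,$$ where $x$ is the unique positive real root of the polynomial $p(x)=x^n-(F_n-b)x-(F_{n-1}-a)$.
   Context: Here $\phi=\frac{1+\sqrt5}{2}$, and $F_m$ is the $m$-th Fibonacci number, with $F_0=0$, $F_1=1$, $F_{m+2}=F_{m+1}+F_m$. The values $a=0$ and $b=0$ are allowed. Ammann Chair tiling. There are two tile types, small ($S$) and big ($B$); they are similar, and the big tile is larger than the small tile by the linear factor $\phi^{1/2}$. One substitution step replaces a small tile by one big tile ($S\to B$) and a big tile by one small and one big tile ($B\to S+B$), with linear inflation factor $\phi^{1/2}$ (equivalently, the new tiles are scaled down by $\phi^{-1/2}$, so that the region covered is unchanged). Gen $n$ is the result of $n$ steps starting from a single small tile. It consists of $F_{n-1}$ small tiles and $F_n$ big tiles. Performing $n$ steps at once is called the $n$-substitution; its inflation factor is $r=\phi^{n/2}$. It replaces a small tile by a copy of Gen $n$ and a big tile by a copy of Gen $n+1$. $(n,a,b)$-Ammann Chair Fractal. Choose $a$ small tiles and $b$ big tiles of Gen $n$ to be removed. The region covered by the chosen tiles is removed at every iteration of the $n$-substitution. The resulting limiting self-similar set is an $(n,a,b)$-Ammann Chair Fractal. Similarity dimension. The part of the fractal in a small tile, scaled by $r=\phi^{n/2}$, consists of $F_{n-1}-a$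 copies of the part of the fractal in a small tile and $F_n-b$ copies of the part of the fractal in a big tile, where a big-tile part is a small-tile part scaled by $\phi^{1/2}$ and therefore counts as $(\phi^{1/2})^d$ small-tile copies in dimension $d$. The similarity dimension $d\ge 0$ of the fractal is determined by (scaling factor)$^d$ = number of copies, i.e. $$\left(\phi^{n/2}\right)^d=(F_{n-1}-a)+\phi^{d/2}(F_n-b).$$
   Formalization: The formal theorem assumes n ≥ 2: for n = 1 the only admissible case is a = b = 0, where p(x) = x − x is the zero polynomial and has no unique positive root, and for n = 0 the number F_{n-1} is undefined (with F_{-1} = 1, p is again zero). *)

theory Defs
  imports Complex_Main "HOL-Number_Theory.Fib" "HOL-Computational_Algebra.Polynomial"
begin

definition golden :: real where
  "golden = (1 + sqrt 5) / 2"

definition sqg :: real where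
  "sqg = sqrt golden"

lemma sqg_pos: "sqg > 0"
  by (simp add: sqg_def golden_def add_pos_nonneg)

lemma sqg_sq: "sqg ^ 2 = golden"
  by (simp add: sqg_def golden_def)

lemma sqg_4: "sqg ^ 4 = sqg ^ 2 + 1"
proof -
  have "sqg ^ 4 = golden ^ 2"
    by (simp flip: sqg_sq)
  then show ?thesis
    by (simp add: sqg_sq) (simp add: golden_def power2_eq_square field_simps)
qed

text \<open>The plane is identified with \<^typ>\<open>complex\<close>. The small prototile is the L-shaped hexagon whose
  side lengths are the powers \<open>0, \<dots>, 5\<close> of \<^const>\<open>sqg\<close>. The big prototile is this
  hexagon scaled by \<^const>\<open>sqg\<close>.\<close>

definition chair :: "complex set" where
  "chair = {z. 0 \<le> Re z \<and> Re z \<le> sqg ^ 5 \<and> 0 \<le> Im z \<and> Im z \<le> sqg ^ 2}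
         \<union> {z. 0 \<le> Re z \<and> Re z \<le> sqg ^ 3 \<and> 0 \<le> Im z \<and> Im z \<le> sqg ^ 4}"

text \<open>The chair splits into two similar chairs, of relative sizes \<open>1 / sqg\<close> (turned by a right angle)
  and \<open>1 / sqg\<^sup>2\<close> (reflected); see \<open>chair_split\<close> below.\<close>

definition to_big :: "complex \<Rightarrow> complex" where
  "to_big z = \<i> * of_real (sqg ^ 4) - \<i> * z / of_real sqg"

definition to_small :: "complex \<Rightarrow> complex" where
  "to_small z = of_real (sqg ^ 5) - cnj z / of_real (sqg ^ 2)"

lemma chair_split: "chair = to_big ` chair \<union> to_small ` chair"
proof -
  have s: "sqg > 0" "sqg \<noteq> 0" by (simp_all add: sqg_pos less_imp_neq[symmetric])
  have p5: "sqg ^ 5 = sqg ^ 3 + sqg"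
  proof -
    have "sqg ^ 5 = sqg * (sqg ^ 2 + 1)"
      unfolding sqg_4[symmetric] by (simp add: eval_nat_numeral)
    then show ?thesis by (simp add: algebra_simps eval_nat_numeral)
  qed
  have big: "w \<in> to_big ` chair \<longleftrightarrow>
      0 \<le> Im w \<and> Im w \<le> sqg ^ 4 \<and> 0 \<le> Re w \<and> Re w \<le> sqg
      \<or> 1 \<le> Im w \<and> Im w \<le> sqg ^ 4 \<and> 0 \<le> Re w \<and> Re w \<le> sqg ^ 3" for w
  proof -
    define z where "z = Complex (sqg * (sqg ^ 4 - Im w)) (sqg * Re w)"
    have eq: "to_big v = w \<longleftrightarrow> v = z" for v
      using s by (auto simp: to_big_def z_def complex_eq_iff field_simps)
    have "w \<in> to_big ` chair \<longleftrightarrow> z \<in> chair"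
      using eq by (metis image_iff)
    moreover have "0 \<le> Re z \<longleftrightarrow> Im w \<le> sqg ^ 4" "0 \<le> Im z \<longleftrightarrow> 0 \<le> Re w"
      using s by (auto simp: z_def zero_le_mult_iff)
    moreover have "Re z \<le> sqg ^ 5 \<longleftrightarrow> 0 \<le> Im w"
    proof -
      have "Re z \<le> sqg ^ 5 \<longleftrightarrow> sqg * (sqg ^ 4 - Im w) \<le> sqg * sqg ^ 4"
        by (simp add: z_def eval_nat_numeral)
      then show ?thesis using s by (simp only: mult_le_cancel_left_pos) simp
    qed
    moreover have "Re z \<le> sqg ^ 3 \<longleftrightarrow> 1 \<le> Im w"
    proof -
      have "Re z \<le> sqg ^ 3 \<longleftrightarrow> sqg * (sqg ^ 4 - Im w) \<le> sqg * sqg ^ 2"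
        by (simp add: z_def eval_nat_numeral)
      then show ?thesis using s sqg_4 by (simp only: mult_le_cancel_left_pos) auto
    qed
    moreover have "Im z \<le> sqg ^ 2 \<longleftrightarrow> Re w \<le> sqg"
    proof -
      have "Im z \<le> sqg ^ 2 \<longleftrightarrow> sqg * Re w \<le> sqg * sqg"
        by (simp add: z_def eval_nat_numeral)
      then show ?thesis using s by (simp only: mult_le_cancel_left_pos)
    qed
    moreover have "Im z \<le> sqg ^ 4 \<longleftrightarrow> Re w \<le> sqg ^ 3"
    proof -
      have "Im z \<le> sqg ^ 4 \<longleftrightarrow> sqg * Re w \<le> sqg * sqg ^ 3"
        by (simp add: z_def eval_nat_numeral)
      then show ?thesis using s by (simp only: mult_le_cancel_left_pos)
    qed
    ultimately show ?thesis by (auto simp: chair_def)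
  qed
  have small: "w \<in> to_small ` chair \<longleftrightarrow>
      sqg \<le> Re w \<and> Re w \<le> sqg ^ 5 \<and> 0 \<le> Im w \<and> Im w \<le> 1
      \<or> sqg ^ 3 \<le> Re w \<and> Re w \<le> sqg ^ 5 \<and> 0 \<le> Im w \<and> Im w \<le> sqg ^ 2" for w
  proof -
    define z where "z = Complex (sqg ^ 2 * (sqg ^ 5 - Re w)) (sqg ^ 2 * Im w)"
    have s2: "sqg ^ 2 > 0" using s by simp
    have eq: "to_small v = w \<longleftrightarrow> v = z" for v
    proof -
      have "Re (to_small v) = sqg ^ 5 - Re v / sqg ^ 2" "Im (to_small v) = Im v / sqg ^ 2"
        unfolding to_small_def by (simp_all del: of_real_power)
      moreover have "A - x / c = y \<longleftrightarrow> x = c * (A - y)" "x / c = y \<longleftrightarrow> x = c * y"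
        if "c > 0" for A c x y :: real
        using that by (auto simp: field_simps)
      ultimately show ?thesis using s2 by (simp add: z_def complex_eq_iff)
    qed
    have "w \<in> to_small ` chair \<longleftrightarrow> z \<in> chair"
      using eq by (metis image_iff)
    moreover have "0 \<le> Re z \<longleftrightarrow> Re w \<le> sqg ^ 5" "0 \<le> Im z \<longleftrightarrow> 0 \<le> Im w"
      using s2 s by (auto simp: z_def zero_le_mult_iff)
    moreover have "Re z \<le> sqg ^ 5 \<longleftrightarrow> sqg \<le> Re w"
    proof -
      have "Re z \<le> sqg ^ 5 \<longleftrightarrow> sqg ^ 2 * (sqg ^ 5 - Re w) \<le> sqg ^ 2 * sqg ^ 3"
        by (simp add: z_def eval_nat_numeral mult_ac)
      then show ?thesis using s2 p5 by (simp only: mult_le_cancel_left_pos) auto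
    qed
    moreover have "Re z \<le> sqg ^ 3 \<longleftrightarrow> sqg ^ 3 \<le> Re w"
    proof -
      have "Re z \<le> sqg ^ 3 \<longleftrightarrow> sqg ^ 2 * (sqg ^ 5 - Re w) \<le> sqg ^ 2 * sqg"
        by (simp add: z_def eval_nat_numeral mult_ac)
      then show ?thesis using s2 p5 by (simp only: mult_le_cancel_left_pos) auto
    qed
    moreover have "Im z \<le> sqg ^ 2 \<longleftrightarrow> Im w \<le> 1"
      using s2 mult_le_cancel_left_pos[of "sqg ^ 2" "Im w" 1] by (simp add: z_def)
    moreover have "Im z \<le> sqg ^ 4 \<longleftrightarrow> Im w \<le> sqg ^ 2"
    proof -
      have "Im z \<le> sqg ^ 4 \<longleftrightarrow> sqg ^ 2 * Im w \<le> sqg ^ 2 * sqg ^ 2"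
        by (simp add: z_def eval_nat_numeral mult_ac)
      then show ?thesis using s2 by (simp only: mult_le_cancel_left_pos)
    qed
    ultimately show ?thesis by (auto simp: chair_def)
  qed
  have "0 < sqg ^ 3" "1 \<le> sqg ^ 2"  "sqg ^ 2 \<le> sqg ^ 4"
    using s by (simp_all add: sqg_4) (simp add: sqg_sq golden_def)
  moreover have "sqg \<le> sqg ^ 3"
    using mult_left_mono[of 1 "sqg ^ 2" sqg] s \<open>1 \<le> sqg ^ 2\<close> by (simp add: eval_nat_numeral)
  ultimately have "w \<in> chair \<longleftrightarrow> w \<in> to_big ` chair \<or> w \<in> to_small ` chair" for w
    unfolding big small using p5 s by (auto simp: chair_def)
  then show ?thesis by blast
qed

datatype kind = Small | Big

text \<open>A placed tile is its kind together with the similarity carrying \<^const>\<open>chair\<close> onto the region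
  covered by the tile. New tiles are scaled down, so the covered region does not change: a small
  tile turns into a big tile of the finer generation without moving.\<close>

type_synonym tile = "kind \<times> (complex \<Rightarrow> complex)"

fun subst_tile :: "tile \<Rightarrow> tile list" where
  "subst_tile (Small, f) = [(Big, f)]"
| "subst_tile (Big, f) = [(Small, f \<circ> to_small), (Big, f \<circ> to_big)]"

fun gen :: "nat \<Rightarrow> tile list" where
  "gen 0 = [(Small, id)]"
| "gen (Suc n) = concat (map subst_tile (gen n))"

definition count_kind :: "kind \<Rightarrow> tile list \<Rightarrow> nat" where
  "count_kind k ts = length (filter (\<lambda>t. fst t = k) ts)"

lemma gen_counts:
  "count_kind Small (gen (Suc n)) = fib n" "count_kind Big (gen (Suc n)) = fib (Suc n)"
proof -
  have step: "count_kind Small (concat (map subst_tile ts)) = count_kind Big ts"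
    "count_kind Big (concat (map subst_tile ts)) = count_kind Small ts + count_kind Big ts" for ts
  proof (induction ts)
    case (Cons t ts)
    obtain k f where "t = (k, f)" by (cases t)
    case 1 then show ?case using \<open>t = (k, f)\<close> Cons by (cases k) (auto simp: count_kind_def)
    case 2 then show ?case using \<open>t = (k, f)\<close> Cons by (cases k) (auto simp: count_kind_def)
  qed (auto simp: count_kind_def)
  have "count_kind Small (gen (Suc n)) = fib n \<and> count_kind Big (gen (Suc n)) = fib (Suc n)"
  proof (induction n)
    case 0
    show ?case by (simp add: count_kind_def)
  next
    case (Suc n)
    then show ?case using step[of "gen (Suc n)"] by simp
  qed
  then show "count_kind Small (gen (Suc n)) = fib n" "count_kind Big (gen (Suc n)) = fib (Suc n)"
    by auto
qed

text \<open>The removed tiles are given by their positions in the list \<^term>\<open>gen n\<close>.\<close>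

definition removal :: "nat \<Rightarrow> nat \<Rightarrow> nat \<Rightarrow> nat set \<Rightarrow> bool" where
  "removal n a b R \<longleftrightarrow>
     R \<subseteq> {..<length (gen n)} \<and>
     count_kind Small (nths (gen n) R) = a \<and>
     count_kind Big (nths (gen n) R) = b"

definition kept :: "nat \<Rightarrow> nat set \<Rightarrow> tile list" where
  "kept n R = nths (gen n) (- R)"

text \<open>Tiles are closed, so removing a tile leaves its boundary with the neighbouring kept tiles. The part
  in a big tile is a scaled copy of the part in a small tile, so all kept tiles, of either kind,
  are refined by the same rule.\<close>

fun stage :: "nat \<Rightarrow> nat set \<Rightarrow> nat \<Rightarrow> complex set" where
  "stage n R 0 = chair"
| "stage n R (Suc k) = (\<Union>(_, f) \<in> set (kept n R). f ` stage n R k)"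

definition ammann_chair_fractal :: "nat \<Rightarrow> nat set \<Rightarrow> complex set" where
  "ammann_chair_fractal n R = (\<Inter>k. stage n R k)"

definition similarity :: "real \<Rightarrow> (complex \<Rightarrow> complex) \<Rightarrow> bool" where
  "similarity c f \<longleftrightarrow> (\<forall>z w. dist (f z) (f w) = c * dist z w)"

definition inflation :: "nat \<Rightarrow> real" where
  "inflation n = golden powr (real n / 2)"

fun kind_size :: "kind \<Rightarrow> real" where
  "kind_size Small = 1"
| "kind_size Big = golden powr (1 / 2)"

text \<open>Scaled by \<^term>\<open>inflation n\<close>, the fractal consists of one congruent copy of itself for each kept
  small tile and one congruent copy of itself scaled by \<open>golden powr (1/2)\<close> for each kept big
  tile; the latter counts as \<open>(golden powr (1/2)) powr d\<close> copies.\<close>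

definition has_similarity_dimension :: "nat \<Rightarrow> nat set \<Rightarrow> real \<Rightarrow> bool" where
  "has_similarity_dimension n R d \<longleftrightarrow>
     ammann_chair_fractal n R = (\<Union>(_, f) \<in> set (kept n R). f ` ammann_chair_fractal n R) \<and>
     (\<forall>(k, f) \<in> set (kept n R). similarity (kind_size k / inflation n) f) \<and>
     0 \<le> d \<and>
     inflation n powr d =
       real (count_kind Small (kept n R)) * kind_size Small powr d
       + real (count_kind Big (kept n R)) * kind_size Big powr d"

definition ammann_poly :: "nat \<Rightarrow> nat \<Rightarrow> nat \<Rightarrow> real poly" where
  "ammann_poly n a b =
     monom 1 n - monom (real (fib n) - real b) 1 - [:real (fib (n - 1)) - real a:]"

end

theory Submission
  imports Defs
begin

text \<open>With \<open>y = golden powr (d / 2)\<close> the similarity dimension equation becomes the polynomial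
  equation \<open>y\<^sup>n = B y + A\<close>, where \<open>A\<close> and \<open>B\<close> count the kept small and big tiles. It has exactly one
  positive root, because \<open>y\<^sup>n\<^sup>-\<^sup>1 - A / y\<close> is strictly increasing, and this root is at least \<open>1\<close>, so
  \<open>d \<ge> 0\<close>. The limiting set is self-similar because the stages decrease and there are finitely many
  injective maps: a point lying in every stage is reached through one and the same map
  infinitely often.\<close>

section \<open>Golden ratio and inflation factor\<close>

lemma golden_gt_1: "golden > 1"
proof -
  have "sqrt 5 > sqrt 1" by (rule real_sqrt_less_mono) simp
  then show ?thesis by (simp add: golden_def)
qed

lemma sqg_powr: "sqg = golden powr (1 / 2)"
  using golden_gt_1 by (simp add: sqg_def powr_half_sqrt)

lemma inflation_0: "inflation 0 = 1"
  using golden_gt_1 by (simp add: inflation_def)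

lemma inflation_Suc: "inflation (Suc n) = inflation n * sqg"
  using golden_gt_1
  by (simp add: inflation_def sqg_powr powr_add[symmetric] add_divide_distrib add.commute)

lemma inflation_pos: "inflation n > 0"
  using golden_gt_1 by (simp add: inflation_def)

section \<open>Scaling factors of the tile maps\<close>

lemma similarity_id: "similarity 1 id"
  by (simp add: similarity_def)

lemma similarity_comp:
  "similarity c f \<Longrightarrow> similarity e g \<Longrightarrow> similarity (c * e) (f \<circ> g)"
  by (simp add: similarity_def)

lemma inj_similarity:
  assumes "similarity c f" "c \<noteq> 0"
  shows "inj f"
proof (rule injI)
  fix x y assume "f x = f y"
  then have "c * dist x y = 0" using assms(1) by (metis similarity_def dist_self)
  then show "x = y" using assms(2) by simp
qed

lemma similarity_to_big: "similarity (1 / sqg) to_big"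
  unfolding similarity_def
proof (intro allI)
  fix z w :: complex
  have "to_big z - to_big w = (- \<i> / of_real sqg) * (z - w)"
    by (simp add: to_big_def algebra_simps diff_divide_distrib)
  then show "dist (to_big z) (to_big w) = 1 / sqg * dist z w"
    using sqg_pos by (simp add: dist_norm norm_mult norm_divide)
qed

lemma similarity_to_small: "similarity (1 / sqg ^ 2) to_small"
  unfolding similarity_def
proof (intro allI)
  fix z w :: complex
  have "to_small z - to_small w = - cnj (z - w) / of_real (sqg ^ 2)"
    by (simp add: to_small_def diff_divide_distrib)
  then have "dist (to_small z) (to_small w) = norm (cnj (z - w)) / \<bar>sqg ^ 2\<bar>"
    by (simp only: dist_norm norm_divide norm_of_real norm_minus_cancel)
  then show "dist (to_small z) (to_small w) = 1 / sqg ^ 2 * dist z w"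
    by (simp only: complex_mod_cnj dist_norm) simp
qed

text \<open>A small tile keeps its map and becomes big, so \<open>kind_size\<close> and
  \<open>inflation\<close> both gain the factor \<open>sqg\<close>. The map of a big tile, of factor
  \<open>sqg / inflation n\<close>, is composed with contractions by \<open>1 / sqg ^ 2\<close> and
  \<open>1 / sqg\<close>.\<close>

lemma subst_tile_similarity:
  assumes "(k', g) \<in> set (subst_tile (k, f))" "similarity (kind_size k / inflation n) f"
  shows "similarity (kind_size k' / inflation (Suc n)) g"
proof (cases k)
  case Small
  then show ?thesis using assms sqg_pos
    by (simp add: inflation_Suc sqg_powr[symmetric])
next
  case Big
  have *: "sqg / inflation n * (1 / sqg ^ 2) = 1 / inflation (Suc n)"
    "sqg / inflation n * (1 / sqg) = sqg / inflation (Suc n)"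
    using sqg_pos by (simp_all add: inflation_Suc power2_eq_square)
  have "similarity (sqg / inflation n) f"
    using assms(2) Big by (simp add: sqg_powr)
  then have "similarity (1 / inflation (Suc n)) (f \<circ> to_small)"
    "similarity (sqg / inflation (Suc n)) (f \<circ> to_big)"
    using similarity_comp similarity_to_small similarity_to_big * by metis+
  then show ?thesis using assms(1) Big by (auto simp: sqg_powr)
qed

lemma gen_similarity:
  "(k, f) \<in> set (gen n) \<Longrightarrow> similarity (kind_size k / inflation n) f"
proof (induction n arbitrary: k f)
  case 0
  then show ?case using similarity_id by (simp add: inflation_0 id_def)
next
  case (Suc n)
  then obtain k0 f0 where "(k0, f0) \<in> set (gen n)" "(k, f) \<in> set (subst_tile (k0, f0))"
    by auto
  then show ?case using Suc.IH subst_tile_similarity by blast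
qed

text \<open>By \<open>chair_split\<close> both children of a big tile lie inside it, and a small
  tile passes on its map unchanged.\<close>

lemma gen_image_chair: "(k, f) \<in> set (gen n) \<Longrightarrow> f ` chair \<subseteq> chair"
proof (induction n arbitrary: k f)
  case 0
  then show ?case by simp
next
  case (Suc n)
  then obtain k0 f0 where 0: "(k0, f0) \<in> set (gen n)" "(k, f) \<in> set (subst_tile (k0, f0))"
    by auto
  have "f ` chair \<subseteq> f0 ` chair"
  proof (cases k0)
    case Big
    have "to_big ` chair \<subseteq> chair" "to_small ` chair \<subseteq> chair"
      using chair_split by blast+
    then show ?thesis using 0(2) Big by auto
  qed (use 0(2) in auto)
  then show ?case using Suc.IH[OF 0(1)] by blast
qed

section \<open>Decreasing stages and self-similarity of the limit\<close>

lemma set_kept: "set (kept n R) \<subseteq> set (gen n)"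
  by (simp add: kept_def set_nths_subset)

text \<open>Initially this is the inclusion of tiles in \<open>chair\<close>; it propagates because
  the union of images is monotone in the stage.\<close>

lemma stage_Suc_subset: "stage n R (Suc k) \<subseteq> stage n R k"
proof (induction k)
  case 0
  show ?case using gen_image_chair set_kept by (fastforce simp del: image_subset_iff)
next
  case (Suc k)
  then have "(\<Union>(_, f) \<in> set (kept n R). f ` stage n R (Suc k))
    \<subseteq> (\<Union>(_, f) \<in> set (kept n R). f ` stage n R k)"
    by (intro UN_mono) (auto simp del: stage.simps)
  then show ?case by simp
qed

lemma antimono_stage: "antimono (stage n R)"
  using stage_Suc_subset by (rule decseq_SucI)

lemma INT_UN_image_antimono:
  fixes S :: "nat \<Rightarrow> 'a set"
  assumes fin: "finite F" and inj: "\<And>f. f \<in> F \<Longrightarrow> inj f" and S: "antimono S"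
  shows "(\<Inter>k. \<Union>f\<in>F. f ` S k) = (\<Union>f\<in>F. f ` (\<Inter>k. S k))"
proof (intro equalityI subsetI)
  fix x assume x: "x \<in> (\<Inter>k. \<Union>f\<in>F. f ` S k)"
  show "x \<in> (\<Union>f\<in>F. f ` (\<Inter>k. S k))"
  proof (rule ccontr)
    assume "x \<notin> (\<Union>f\<in>F. f ` (\<Inter>k. S k))"
    then have "\<forall>f\<in>F. \<exists>k. x \<notin> f ` S k"
      using inj by (simp add: image_INT[of _ UNIV UNIV S, simplified])
    then obtain m where m: "\<And>f. f \<in> F \<Longrightarrow> x \<notin> f ` S (m f)" by metis
    \<comment> \<open>Finiteness of \<open>F\<close> bounds all failure stages at once; whichever
      map reaches \<open>x\<close> at stage \<open>M\<close> also reaches it at its own, earlier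
      failure stage.\<close>
    obtain M where M: "\<And>f. f \<in> F \<Longrightarrow> m f \<le> M"
      using finite_nat_set_iff_bounded_le[of "m ` F"] fin by auto
    obtain f where f: "f \<in> F" "x \<in> f ` S M" using x by blast
    then have "x \<in> f ` S (m f)" using antimonoD[OF S M] by blast
    then show False using m f(1) by blast
  qed
qed blast

lemma fractal_self_similar:
  "ammann_chair_fractal n R = (\<Union>(_, f) \<in> set (kept n R). f ` ammann_chair_fractal n R)"
proof -
  let ?F = "snd ` set (kept n R)"
  have inj: "inj f" if f: "f \<in> ?F" for f
  proof -
    obtain k where "(k, f) \<in> set (kept n R)" using f by auto
    then have "(k, f) \<in> set (gen n)" using set_kept by blast
    moreover have "kind_size k / inflation n \<noteq> 0"
      using inflation_pos[of n] golden_gt_1 by (cases k) auto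
    ultimately show ?thesis using gen_similarity inj_similarity by blast
  qed
  \<comment> \<open>Dropping stage 0 does not change the intersection, since the stages
    decrease.\<close>
  have "ammann_chair_fractal n R = (\<Inter>k. stage n R (Suc k))"
    unfolding ammann_chair_fractal_def using stage_Suc_subset by blast
  also have "\<dots> = (\<Inter>k. \<Union>f\<in>?F. f ` stage n R k)"
    by (simp add: case_prod_beta)
  also have "\<dots> = (\<Union>f\<in>?F. f ` ammann_chair_fractal n R)"
    unfolding ammann_chair_fractal_def
    using inj antimono_stage by (intro INT_UN_image_antimono) auto
  finally show ?thesis by (simp add: case_prod_beta)
qed

section \<open>Counting the kept tiles\<close>

lemma length_filter_nths_Compl:
  "length (filter P (nths xs R)) + length (filter P (nths xs (- R))) = length (filter P xs)"
  \<comment> \<open>Appending at the end leaves earlier positions fixed, so \<open>R\<close> need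
    not be shifted.\<close>
  by (induction xs rule: rev_induct) (auto simp: nths_append)

lemma kept_counts:
  assumes "removal n a b R" "n \<ge> 1"
  shows "count_kind Small (kept n R) = fib (n - 1) - a"
    "count_kind Big (kept n R) = fib n - b"
proof -
  \<comment> \<open>The formula fails for \<open>n = 0\<close>: \<open>gen 0\<close> has one small
    tile, while the truncated index gives \<open>fib 0 = 0\<close>.\<close>
  obtain m where m: "n = Suc m" using assms(2) by (cases n) auto
  have "count_kind k (nths (gen n) R) + count_kind k (kept n R) = count_kind k (gen n)" for k
    by (simp add: count_kind_def kept_def length_filter_nths_Compl)
  from this[of Small] this[of Big]
  show "count_kind Small (kept n R) = fib (n - 1) - a"
    "count_kind Big (kept n R) = fib n - b"
    using assms(1) gen_counts[of m] unfolding m removal_def by auto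
qed

section \<open>The positive root of the polynomial equation\<close>

lemma power_eq_linear_unique:
  fixes y z A B :: real
  assumes n: "n \<ge> 2" and A: "A \<ge> 0"
    and y: "0 < y" "y ^ n = B * y + A" and z: "0 < z" "z ^ n = B * z + A"
  shows "y = z"
proof -
  have False if h: "0 < u" "u < v" "u ^ n = B * u + A" "v ^ n = B * v + A" for u v :: real
  proof -
    have eq: "w ^ n = w * w ^ (n - 1)" for w :: real
      using n by (simp add: power_eq_if)
    \<comment> \<open>Cross-multiplying cancels the terms in \<open>B\<close>; this is the
      comparison of \<open>y ^ (n - 1) - A / y\<close> at \<open>u\<close> and \<open>v\<close> with
      denominators cleared.\<close>
    have "v * u ^ n - u * v ^ n = A * (v - u)"
      using h by (simp add: algebra_simps)
    also have "\<dots> \<ge> 0" using A h by simp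
    finally have "(u * v) * v ^ (n - 1) \<le> (u * v) * u ^ (n - 1)"
      by (simp add: eq mult_ac)
    then have "v ^ (n - 1) \<le> u ^ (n - 1)" using h by simp
    \<comment> \<open>Strictness needs \<open>n - 1 > 0\<close>; for \<open>n = 1\<close>,
      \<open>A = 0\<close>, \<open>B = 1\<close> every number is a root.\<close>
    moreover have "u ^ (n - 1) < v ^ (n - 1)"
      using h n by (intro power_strict_mono) auto
    ultimately show False by simp
  qed
  then show ?thesis using y z by (metis linorder_neqE_linordered_idom)
qed

lemma power_eq_linear_exists:
  fixes A B :: real
  assumes n: "n \<ge> 2" and AB: "A \<ge> 0" "A + B \<ge> 1"
  shows "\<exists>x\<ge>1. x ^ n = B * x + A"
proof -
  \<comment> \<open>The intermediate value theorem is applied on \<open>[1, A + B]\<close>: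
    \<open>?f 1 = 1 - (A + B)\<close> is nonpositive, and at \<open>?M\<close> the linear part is at
    most \<open>?M ^ 2\<close>.\<close>
  let ?f = "\<lambda>x. x ^ n - B * x - A" and ?M = "A + B"
  have "B * ?M + A \<le> B * ?M + A * ?M"
    using mult_left_mono[of 1 ?M A] AB by simp
  also have "\<dots> = ?M ^ 2" by (simp add: algebra_simps power2_eq_square)
  also have "\<dots> \<le> ?M ^ n" using n AB by (intro power_increasing) auto
  finally have "\<exists>x. 1 \<le> x \<and> x \<le> ?M \<and> ?f x = 0"
    using AB by (intro IVT') (auto intro!: continuous_intros)
  then show ?thesis by (auto simp: algebra_simps)
qed

lemma poly_ammann_poly:
  assumes "a \<le> fib (n - 1)" "b \<le> fib n"
  shows "poly (ammann_poly n a b) y = 0 \<longleftrightarrow>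
    y ^ n = real (fib n - b) * y + real (fib (n - 1) - a)"
  \<comment> \<open>The bounds on \<open>a\<close> and \<open>b\<close> make the truncated
    subtractions agree with the real ones in \<open>ammann_poly\<close>.\<close>
  using assms by (auto simp: ammann_poly_def poly_monom of_nat_diff algebra_simps)

text \<open>The geometric conditions hold for every \<open>R\<close>, so only the numerical equation
  remains; its left side is \<open>golden powr (n * d / 2)\<close>.\<close>

lemma has_similarity_dimension_iff:
  "has_similarity_dimension n R d \<longleftrightarrow> 0 \<le> d \<and>
    (golden powr (d / 2)) ^ n =
      real (count_kind Big (kept n R)) * golden powr (d / 2) + real (count_kind Small (kept n R))"
proof -
  have "\<forall>(k, f) \<in> set (kept n R). similarity (kind_size k / inflation n) f"
    using set_kept gen_similarity by blast
  moreover have "inflation n powr d = (golden powr (d / 2)) ^ n"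
    using golden_gt_1 by (simp add: inflation_def powr_powr mult.commute flip: powr_realpow)
  moreover have "kind_size Big powr d = golden powr (d / 2)"
    by (simp add: powr_powr)
  ultimately show ?thesis
    using fractal_self_similar[of n R] by (simp add: has_similarity_dimension_def add.commute)
qed

theorem theorem5p1:
  fixes n a b :: nat
  assumes "2 \<le> n"
    and "a \<le> fib (n - 1)"
    and "b \<le> fib n"
    and "\<not> (a = fib (n - 1) \<and> b = fib n)"
  shows "\<exists>x::real. (0 < x \<and> poly (ammann_poly n a b) x = 0)
    \<and> (\<forall>y. 0 < y \<and> poly (ammann_poly n a b) y = 0 \<longrightarrow> y = x)
    \<and> (\<forall>R. removal n a b R \<longrightarrow>
         (\<forall>d. has_similarity_dimension n R d \<longleftrightarrow> d = 2 * log golden x))"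
proof -
  define A where "A = real (fib (n - 1) - a)"
  define B where "B = real (fib n - b)"
  have "A \<ge> 0" by (simp add: A_def)
  \<comment> \<open>At least one tile is kept, as the case of removing all tiles is
    excluded.\<close>
  have "A + B \<ge> 1" using assms(2-4) unfolding A_def B_def by linarith
  then obtain x where x: "x \<ge> 1" "x ^ n = B * x + A"
    using power_eq_linear_exists[OF assms(1) \<open>A \<ge> 0\<close>] by blast
  have uniq: "y = x" if "0 < y" "y ^ n = B * y + A" for y
    using power_eq_linear_unique[OF assms(1) \<open>A \<ge> 0\<close> that] x by simp
  have root: "poly (ammann_poly n a b) y = 0 \<longleftrightarrow> y ^ n = B * y + A" for y
    using poly_ammann_poly[OF assms(2,3)] by (simp add: A_def B_def)
  have dim: "has_similarity_dimension n R d \<longleftrightarrow> d = 2 * log golden x" if "removal n a b R" for R d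
  proof -
    have "has_similarity_dimension n R d \<longleftrightarrow>
        0 \<le> d \<and> (golden powr (d / 2)) ^ n = B * golden powr (d / 2) + A"
      using has_similarity_dimension_iff kept_counts[OF that] assms(1) by (simp add: A_def B_def)
    also have "\<dots> \<longleftrightarrow> 0 \<le> d \<and> golden powr (d / 2) = x"
      using uniq x(2) golden_gt_1 by auto
    also have "\<dots> \<longleftrightarrow> d = 2 * log golden x"
    proof -
      have "golden powr (d / 2) = x \<longleftrightarrow> log golden x = d / 2"
        using golden_gt_1 x(1) by auto
      \<comment> \<open>Since \<open>x \<ge> 1\<close>, the condition \<open>0 \<le> d\<close>
        follows from the equation for \<open>d\<close>.\<close>
      moreover have "log golden x \<ge> 0" using golden_gt_1 x(1) by simp
      ultimately show ?thesis by auto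
    qed
    finally show ?thesis .
  qed
  show ?thesis
    using x uniq root dim by (intro exI[of _ x]) auto
qed

end
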